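(* Let $K$ and $L$ be bounded, distributive lattices and let $h\colon K\to L$ be a lattice homomorphism. Let $C_K\colon K\times K\to I$ and $C_L\colon L\times L\to J$ be representations of the Conley forms on $K$ and $L$ in meet semilattices $I$ and $J$, with images $I_C=C_K(K\times K)$ and $J_C=C_L(L\times L)$. Then $h$ induces a (well-defined) map $\theta\colon I_C\to J_C$ given by $$\theta\bigl(C_K(a,b)\bigr):=C_L\bigl(h(a),h(b)\bigr),\qquad a,b\in K,$$ and $\theta$ is a meet semilattice homomorphism preserving both neutral elements, i.e. $\theta(C_K(0,1))=C_L(0,1)$ and $\theta(C_K(1,0))=C_L(1,0)$.
   Context: Lattice homomorphisms preserve $0$ and $1$. For a bounded distributive lattice $L$, let $\Sigma(L)$ be the set of (proper) prime ideals, $j(a)=\{P\in\Sigma(L)\mid a\notin P\}$, $B^{\updownarrow}(L)=\{j(a)\setminus j(b)\mid a,b\in L\}$ (a meet semilattice under intersection), and $C^{\sigma}(a,b)=j(a)\setminus j(b)$. A representation of the Conley form on $L$ in a meet semilattice $I$ is a map $C=\gamma\circ C^{\sigma}\colon L\times L\to I$ with $\gamma\colon B^{\updownarrow}(L)\to I$ an injective meet semilattice homomorphism. The neutral elements (bottom and top) of its image are $C(0,1)$ and $C(1,0)$. *)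

theory Defs
  imports Main
begin

definition lattice_ideal :: "'a::lattice set \<Rightarrow> bool" where
  "lattice_ideal P \<longleftrightarrow> P \<noteq> {} \<and> (\<forall>a\<in>P. \<forall>b\<le>a. b \<in> P) \<and> (\<forall>a\<in>P. \<forall>b\<in>P. sup a b \<in> P)"

definition lattice_prime_ideal :: "'a::lattice set \<Rightarrow> bool" where
  "lattice_prime_ideal P \<longleftrightarrow>
     lattice_ideal P \<and> P \<noteq> UNIV \<and> (\<forall>a b. inf a b \<in> P \<longrightarrow> a \<in> P \<or> b \<in> P)"

definition lattice_spectrum :: "'a::{distrib_lattice,bounded_lattice} set set" where
  "lattice_spectrum = {P. lattice_prime_ideal P}"

definition priestley_map :: "'a::{distrib_lattice,bounded_lattice} \<Rightarrow> 'a set set" where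
  "priestley_map a = {P \<in> lattice_spectrum. a \<notin> P}"

definition conley_sigma :: "'a::{distrib_lattice,bounded_lattice} \<times> 'a \<Rightarrow> 'a set set" where
  "conley_sigma = (\<lambda>(a, b). priestley_map a - priestley_map b)"

definition locally_closed_sets :: "'a::{distrib_lattice,bounded_lattice} set set set" where
  "locally_closed_sets = {priestley_map a - priestley_map b | a b. True}"

definition bounded_lattice_hom ::
    "('k::bounded_lattice \<Rightarrow> 'l::bounded_lattice) \<Rightarrow> bool" where
  "bounded_lattice_hom h \<longleftrightarrow>
     (\<forall>a b. h (inf a b) = inf (h a) (h b)) \<and> (\<forall>a b. h (sup a b) = sup (h a) (h b)) \<and>
     h bot = bot \<and> h top = top"

definition meet_subsemilattice :: "'i::semilattice_inf set \<Rightarrow> bool" where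
  "meet_subsemilattice A \<longleftrightarrow> (\<forall>x\<in>A. \<forall>y\<in>A. inf x y \<in> A)"

(* The domain and codomain are semilattices under the ambient meet; on families of sets
   that meet is intersection. *)
definition meet_semilattice_hom ::
    "'i::semilattice_inf set \<Rightarrow> 'j::semilattice_inf set \<Rightarrow> ('i \<Rightarrow> 'j) \<Rightarrow> bool" where
  "meet_semilattice_hom A B f \<longleftrightarrow>
     meet_subsemilattice A \<and> meet_subsemilattice B \<and> (\<forall>x\<in>A. f x \<in> B) \<and>
     (\<forall>x\<in>A. \<forall>y\<in>A. f (inf x y) = inf (f x) (f y))"

definition conley_representation ::
    "('a::{distrib_lattice,bounded_lattice} \<times> 'a \<Rightarrow> 'i::semilattice_inf) \<Rightarrow> bool" where
  "conley_representation C \<longleftrightarrow>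
     (\<exists>\<gamma>. meet_semilattice_hom locally_closed_sets UNIV \<gamma> \<and> inj_on \<gamma> locally_closed_sets \<and>
          C = \<gamma> \<circ> conley_sigma)"

lemma lattice_prime_ideal_inf:
  assumes "lattice_prime_ideal P"
  shows "inf a b \<in> P \<longleftrightarrow> a \<in> P \<or> b \<in> P"
proof
  show "inf a b \<in> P \<Longrightarrow> a \<in> P \<or> b \<in> P"
    using assms unfolding lattice_prime_ideal_def by blast
  show "a \<in> P \<or> b \<in> P \<Longrightarrow> inf a b \<in> P"
    using assms inf_le1[of a b] inf_le2[of a b]
    unfolding lattice_prime_ideal_def lattice_ideal_def by blast
qed

lemma lattice_prime_ideal_sup:
  assumes "lattice_prime_ideal P"
  shows "sup a b \<in> P \<longleftrightarrow> a \<in> P \<and> b \<in> P"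
proof
  show "a \<in> P \<and> b \<in> P \<Longrightarrow> sup a b \<in> P"
    using assms unfolding lattice_prime_ideal_def lattice_ideal_def by blast
  show "sup a b \<in> P \<Longrightarrow> a \<in> P \<and> b \<in> P"
    using assms sup_ge1[of a b] sup_ge2[of b a]
    unfolding lattice_prime_ideal_def lattice_ideal_def by blast
qed

lemma priestley_map_inf: "priestley_map (inf a b) = priestley_map a \<inter> priestley_map b"
  unfolding priestley_map_def lattice_spectrum_def
  by (auto simp: lattice_prime_ideal_inf)

lemma priestley_map_sup: "priestley_map (sup a b) = priestley_map a \<union> priestley_map b"
  unfolding priestley_map_def lattice_spectrum_def
  by (auto simp: lattice_prime_ideal_sup)

(* Hence the closure condition imposed on the domain of the representing map is automatic. *)
lemma meet_subsemilattice_locally_closed_sets: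
  "meet_subsemilattice (locally_closed_sets :: 'a::{distrib_lattice,bounded_lattice} set set set)"
  unfolding meet_subsemilattice_def
proof (intro ballI)
  fix X Y :: "'a set set"
  assume "X \<in> locally_closed_sets" "Y \<in> locally_closed_sets"
  then obtain a b c d
    where "X = priestley_map a - priestley_map b" "Y = priestley_map c - priestley_map d"
    unfolding locally_closed_sets_def by auto
  then have "inf X Y = priestley_map (inf a c) - priestley_map (sup b d)"
    unfolding priestley_map_inf priestley_map_sup by auto
  then show "inf X Y \<in> locally_closed_sets"
    unfolding locally_closed_sets_def by (intro CollectI exI conjI TrueI)
qed

lemma range_conley_sigma: "range conley_sigma = locally_closed_sets"
  unfolding conley_sigma_def locally_closed_sets_def by auto

lemma lattice_prime_ideal_bot:
  assumes "lattice_prime_ideal P"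
  shows "bot \<in> (P :: 'a::bounded_lattice set)"
proof -
  obtain a where "a \<in> P"
    using assms unfolding lattice_prime_ideal_def lattice_ideal_def by blast
  then show ?thesis
    using assms bot_least[of a] unfolding lattice_prime_ideal_def lattice_ideal_def by blast
qed

lemma lattice_prime_ideal_top:
  assumes "lattice_prime_ideal P"
  shows "top \<notin> (P :: 'a::bounded_lattice set)"
proof
  assume "top \<in> P"
  then have "x \<in> P" for x
    using assms top_greatest[of x] unfolding lattice_prime_ideal_def lattice_ideal_def by blast
  then show False
    using assms unfolding lattice_prime_ideal_def by blast
qed

lemma priestley_map_bot: "priestley_map bot = {}"
  unfolding priestley_map_def lattice_spectrum_def
  by (auto simp: lattice_prime_ideal_bot)

lemma priestley_map_top: "priestley_map top = lattice_spectrum"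
  unfolding priestley_map_def lattice_spectrum_def
  by (auto simp: lattice_prime_ideal_top)

lemma conley_sigma_neutral:
  "conley_sigma (bot, top) = {}" "conley_sigma (top, bot) = lattice_spectrum"
  by (simp_all add: conley_sigma_def priestley_map_bot priestley_map_top)

end

(* Preimages of prime ideals under h are prime ideals, so the locally closed set of (h a, h b)
   is the preimage of the locally closed set of (a, b) under P \<mapsto> h -` P.  It therefore depends
   only on the latter set, which by injectivity is determined by C_K (a, b). *)
theory Submission
  imports Defs
begin

text \<open>Preservation of \<open>bot\<close> makes the preimage nonempty, and preservation of
  \<open>top\<close> makes it proper.\<close>

lemma lattice_prime_ideal_vimage:
  assumes h: "bounded_lattice_hom h" and P: "lattice_prime_ideal P"
  shows "lattice_prime_ideal (h -` P)"
proof -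
  have hom: "h (inf a b) = inf (h a) (h b)" "h (sup a b) = sup (h a) (h b)"
    "h bot = bot" "h top = top" for a b
    using h unfolding bounded_lattice_hom_def by auto
  have "bot \<in> h -` P" "top \<notin> h -` P"
    using lattice_prime_ideal_bot[OF P] lattice_prime_ideal_top[OF P] hom by auto
  then have "h -` P \<noteq> {}" "h -` P \<noteq> UNIV"
    by blast+
  \<comment> \<open>Here \<open>sup a b = a\<close>, so \<open>sup (h a) (h b) = h a\<close> lies in
    \<open>P\<close>, which forces \<open>h b\<close> into \<open>P\<close>.\<close>
  moreover have "b \<in> h -` P" if "a \<in> h -` P" "b \<le> a" for a b
    using that lattice_prime_ideal_sup[OF P, of "h a" "h b"] hom(2)[of a b]
    by (simp add: sup_absorb1)
  ultimately show ?thesis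
    unfolding lattice_prime_ideal_def lattice_ideal_def
    using lattice_prime_ideal_inf[OF P] lattice_prime_ideal_sup[OF P]
    by (auto simp: hom)
qed

lemma conley_sigma_hom:
  assumes "bounded_lattice_hom h"
  shows "conley_sigma (h a, h b) = {P \<in> lattice_spectrum. h -` P \<in> conley_sigma (a, b)}"
  using lattice_prime_ideal_vimage[OF assms]
  unfolding conley_sigma_def priestley_map_def lattice_spectrum_def by auto

text \<open>\<open>priestley_map\<close> turns \<open>inf\<close> into intersection and
  \<open>sup\<close> into union, and (A - B) \<inter> (C - D) = (A \<inter> C) - (B \<union>
  D).\<close>

lemma conley_sigma_inf:
  "inf (conley_sigma (a, b)) (conley_sigma (c, d)) = conley_sigma (inf a c, sup b d)"
  unfolding conley_sigma_def by (auto simp: priestley_map_inf priestley_map_sup)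

lemma conley_representation_inf:
  assumes "conley_representation C"
  shows "inf (C (a, b)) (C (c, d)) = C (inf a c, sup b d)"
proof -
  obtain \<gamma> where \<gamma>: "meet_semilattice_hom locally_closed_sets UNIV \<gamma>" "C = \<gamma> \<circ> conley_sigma"
    using assms unfolding conley_representation_def by blast
  have "\<gamma> (inf (conley_sigma (a, b)) (conley_sigma (c, d))) =
      inf (\<gamma> (conley_sigma (a, b))) (\<gamma> (conley_sigma (c, d)))"
    using \<gamma>(1) range_conley_sigma unfolding meet_semilattice_hom_def by blast
  then show ?thesis
    using \<gamma>(2) by (simp add: conley_sigma_inf)
qed

text \<open>Injectivity of \<open>\<gamma>\<close> moves equality questions from the abstract
  semilattice to sets of prime ideals; well-definedness of \<open>\<theta>\<close> uses one
  direction for \<open>C\<^sub>K\<close> and the other for \<open>C\<^sub>L\<close>.\<close>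

lemma conley_representation_eq_iff:
  assumes "conley_representation C"
  shows "C x = C y \<longleftrightarrow> conley_sigma x = conley_sigma y"
proof -
  obtain \<gamma> where "inj_on \<gamma> locally_closed_sets" "C = \<gamma> \<circ> conley_sigma"
    using assms unfolding conley_representation_def by blast
  then show ?thesis
    by (metis comp_apply inj_on_eq_iff rangeI range_conley_sigma)
qed

lemma meet_subsemilattice_range_conley_representation:
  assumes "conley_representation C"
  shows "meet_subsemilattice (range C)"
  unfolding meet_subsemilattice_def
  by (auto simp: conley_representation_inf[OF assms])

theorem corollary6p3:
  fixes h :: "'k::{distrib_lattice,bounded_lattice} \<Rightarrow> 'l::{distrib_lattice,bounded_lattice}"
    and C\<^sub>K :: "'k \<times> 'k \<Rightarrow> 'i::semilattice_inf"
    and C\<^sub>L :: "'l \<times> 'l \<Rightarrow> 'j::semilattice_inf"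
  assumes "bounded_lattice_hom h"
    and "conley_representation C\<^sub>K"
    and "conley_representation C\<^sub>L"
  shows "\<exists>\<theta>. (\<forall>a b. \<theta> (C\<^sub>K (a, b)) = C\<^sub>L (h a, h b)) \<and>
             meet_semilattice_hom (range C\<^sub>K) (range C\<^sub>L) \<theta> \<and>
             \<theta> (C\<^sub>K (bot, top)) = C\<^sub>L (bot, top) \<and>
             \<theta> (C\<^sub>K (top, bot)) = C\<^sub>L (top, bot)"
proof -
  have hom: "h (inf a b) = inf (h a) (h b)" "h (sup a b) = sup (h a) (h b)"
    "h bot = bot" "h top = top" for a b
    using assms(1) unfolding bounded_lattice_hom_def by auto
  \<comment> \<open>\<open>inv\<close> picks some pair representing \<open>x\<close>; off
    \<open>range C\<^sub>K\<close> the value is arbitrary.\<close>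
  define \<theta> where "\<theta> x = C\<^sub>L (map_prod h h (inv C\<^sub>K x))" for x
  have \<theta>: "\<theta> (C\<^sub>K (a, b)) = C\<^sub>L (h a, h b)" for a b
  proof -
    obtain c d where cd: "inv C\<^sub>K (C\<^sub>K (a, b)) = (c, d)"
      by fastforce
    then have "C\<^sub>K (c, d) = C\<^sub>K (a, b)"
      by (metis f_inv_into_f rangeI)
    \<comment> \<open>Independence of the chosen pair: both sides are determined by the common set
      \<open>conley_sigma (c, d) = conley_sigma (a, b)\<close>.\<close>
    then have "conley_sigma (h c, h d) = conley_sigma (h a, h b)"
      by (simp add: conley_sigma_hom[OF assms(1)] conley_representation_eq_iff[OF assms(2)])
    then show ?thesis
      by (simp add: \<theta>_def cd conley_representation_eq_iff[OF assms(3)])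
  qed
  \<comment> \<open>Meets in both images are computed on pairs by \<open>inf\<close> in the first
    and \<open>sup\<close> in the second component, and \<open>h\<close> preserves both.\<close>
  have "meet_semilattice_hom (range C\<^sub>K) (range C\<^sub>L) \<theta>"
    unfolding meet_semilattice_hom_def
    using assms(2,3)
    by (auto simp: meet_subsemilattice_range_conley_representation conley_representation_inf \<theta> hom)
  then show ?thesis
    using \<theta> hom(3,4) by (intro exI[of _ \<theta>]) simp
qed

end
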